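(* The associated Hermite polynomials $H_n(x;c)$ are orthogonal with respect to the linear functional $\mathcal{L}_c$, and for all integers $n,m\ge 0$ they satisfy $$\mathcal{L}_c\bigl(H_n(x;c)H_m(x;c)\bigr)=\begin{cases}0 & n\ne m,\\ (c)_n & n=m.\end{cases}$$
   Context: $c$ is an indeterminate and $(a)_n=a(a+1)\cdots(a+n-1)$ is the rising factorial ($(a)_0=1$). The associated Hermite polynomials are defined by $H_0(x;c)=1$, $H_m(x;c)=0$ for $m<0$, and $H_{n+1}(x;c)=xH_n(x;c)-(n-1+c)H_{n-1}(x;c)$ for $n\ge0$. $\mathcal{L}_c$ is the linear functional on polynomials in $x$ whose moments $\mathcal{L}_c(x^n)=\mu_n(c)$ are $\mu_n(c)=\sum_P wt(P)$, where $P$ runs over Dyck paths of length $n$ (paths with $n$ steps, each northeast or southeast, from height $0$ to height $0$, never going below height $0$), and $wt(P)$ is the product of its step weights, a northeast step having weight $1$ and a southeast step leaving from height $j$ having weight $j-1+c$. So $\mu_n(c)=0$ for odd $n$, $\mu_0=1$, $\mu_2=c$, $\mu_4=2c^2+c$, $\mu_6=5c^3+7c^2+3c$. *)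

theory Defs
  imports "HOL-Computational_Algebra.Polynomial"
begin

text \<open>
  Polynomials in \<open>x\<close> over a commutative ring containing the parameter \<open>c\<close> are elements of
  \<open>'a poly\<close>, with \<open>x\<close> being \<open>[:0, 1:]\<close>. The parameter becomes an indeterminate by taking for \<open>'a\<close>
  a polynomial ring and \<open>c = [:0, 1:]\<close> in it.
\<close>

function assoc_hermite :: "'a::comm_ring_1 \<Rightarrow> int \<Rightarrow> 'a poly" where
  "assoc_hermite c m =
    (if m < 0 then 0
     else if m = 0 then 1
     else [:0, 1:] * assoc_hermite c (m - 1)
            - smult (of_int (m - 2) + c) (assoc_hermite c (m - 2)))"
  by pat_completeness auto
termination by (relation "measure (\<lambda>(c, m). nat (m + 1))") auto

declare assoc_hermite.simps [simp del]

lemma assoc_hermite_neg: "m < 0 \<Longrightarrow> assoc_hermite c m = 0"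
  by (simp add: assoc_hermite.simps)

lemma assoc_hermite_0: "assoc_hermite c 0 = 1"
  by (simp add: assoc_hermite.simps)

lemma assoc_hermite_rec:
  assumes "n \<ge> 0"
  shows "assoc_hermite c (n + 1) =
    [:0, 1:] * assoc_hermite c n - smult (of_int (n - 1) + c) (assoc_hermite c (n - 1))"
  using assms by (subst assoc_hermite.simps) simp

datatype step = NE | SE

fun step_rise :: "step \<Rightarrow> int" where
  "step_rise NE = 1"
| "step_rise SE = -1"

definition height :: "step list \<Rightarrow> nat \<Rightarrow> int" where
  "height P i = sum_list (map step_rise (take i P))"

definition dyck_paths :: "nat \<Rightarrow> step list set" where
  "dyck_paths n = {P. length P = n \<and> (\<forall>i\<le>n. height P i \<ge> 0) \<and> height P n = 0}"

lemma finite_dyck_paths: "finite (dyck_paths n)"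
proof -
  have "UNIV = {NE, SE}"
    using step.exhaust by auto
  then have "finite (UNIV :: step set)"
    by (metis finite.emptyI finite.insertI)
  then have "finite {P. set P \<subseteq> (UNIV :: step set) \<and> length P = n}"
    by (rule finite_lists_length_eq)
  then show ?thesis
    by (rule rev_finite_subset) (auto simp: dyck_paths_def)
qed

fun step_weight :: "'a::comm_ring_1 \<Rightarrow> int \<Rightarrow> step \<Rightarrow> 'a" where
  "step_weight c j NE = 1"
| "step_weight c j SE = of_int (j - 1) + c"

definition path_weight :: "'a::comm_ring_1 \<Rightarrow> step list \<Rightarrow> 'a" where
  "path_weight c P = (\<Prod>i<length P. step_weight c (height P i) (P ! i))"

definition moment :: "'a::comm_ring_1 \<Rightarrow> nat \<Rightarrow> 'a" where
  "moment c n = (\<Sum>P\<in>dyck_paths n. path_weight c P)"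

definition moment_functional :: "'a::comm_ring_1 \<Rightarrow> 'a poly \<Rightarrow> 'a" where
  "moment_functional c p = (\<Sum>i\<le>degree p. coeff p i * moment c i)"

lemma moment_functional_upto:
  assumes "degree p \<le> N"
  shows "moment_functional c p = (\<Sum>i\<le>N. coeff p i * moment c i)"
  unfolding moment_functional_def
  by (rule sum.mono_neutral_left) (use assms in \<open>auto simp: coeff_eq_0\<close>)

lemma moment_functional_add:
  "moment_functional c (p + q) = moment_functional c p + moment_functional c q"
proof -
  define N where "N = max (degree p) (degree q)"
  have "degree p \<le> N" "degree q \<le> N" "degree (p + q) \<le> N"
    by (auto simp: N_def intro: degree_add_le)
  then show ?thesis
    by (simp add: moment_functional_upto[where N = N] sum.distrib distrib_right)
qed

lemma moment_functional_smult:
  "moment_functional c (smult a p) = a * moment_functional c p"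
  by (simp add: moment_functional_upto[where N = "degree p"] degree_smult_le
      sum_distrib_left mult.assoc)

lemma moment_functional_power: "moment_functional c ([:0, 1:] ^ n) = moment c n"
proof -
  have "[:0, 1:] ^ n = monom (1 :: 'a) n"
    by (simp add: monom_altdef)
  then show ?thesis
    by (simp add: moment_functional_upto[where N = n] degree_monom_le
        if_distrib[of "\<lambda>t. t * _"] cong: if_cong)
qed

definition orthogonal_polys :: "('a::comm_ring_1 poly \<Rightarrow> 'a) \<Rightarrow> (nat \<Rightarrow> 'a poly) \<Rightarrow> bool" where
  "orthogonal_polys L p \<longleftrightarrow>
    (\<forall>n. degree (p n) = n) \<and>
    (\<forall>n m. n \<noteq> m \<longrightarrow> L (p n * p m) = 0) \<and>
    (\<forall>n. L (p n * p n) \<noteq> 0)"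

end

theory Submission
  imports Defs
begin

text \<open>
  Let \<open>W(n, k)\<close> be the total weight of the nonnegative paths with \<open>n\<close> steps from height \<open>k\<close> to
  height \<open>0\<close>. Splitting off the first step gives \<open>W(n+1, k) = W(n, k+1) + (k-1+c) W(n, k-1)\<close>.
  The three-term recurrence of \<open>H\<^sub>k\<close> gives the same relation for \<open>L(x\<^sup>n H\<^sub>k)\<close>, and the two
  agree at \<open>k = 0\<close>; hence \<open>L(x\<^sup>n H\<^sub>k) = W(n, k)\<close>. A path from \<open>k\<close> to \<open>0\<close> needs at least
  \<open>k\<close> steps, and the only one with exactly \<open>k\<close> steps descends all the way, with weight
  \<open>(c)\<^sub>k\<close>. Since \<open>H\<^sub>n\<close> is monic of degree \<open>n\<close>, orthogonality follows.
\<close>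

section \<open>Weighted paths descending from height \<open>k\<close> to height 0\<close>

definition descents :: "nat \<Rightarrow> int \<Rightarrow> step list set" where
  "descents n k = {P. length P = n \<and> (\<forall>i\<le>n. k + height P i \<ge> 0) \<and> k + height P n = 0}"

definition descent_weight :: "'a::comm_ring_1 \<Rightarrow> int \<Rightarrow> step list \<Rightarrow> 'a" where
  "descent_weight c k P = (\<Prod>i<length P. step_weight c (k + height P i) (P ! i))"

definition descent_sum :: "'a::comm_ring_1 \<Rightarrow> nat \<Rightarrow> int \<Rightarrow> 'a" where
  "descent_sum c n k = (\<Sum>P\<in>descents n k. descent_weight c k P)"

lemma height_0 [simp]: "height P 0 = 0"
  by (simp add: height_def)

lemma height_Cons_Suc [simp]: "height (s # P) (Suc i) = step_rise s + height P i"
  by (simp add: height_def)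

lemma finite_descents: "finite (descents n k)"
proof -
  have "(UNIV :: step set) = {NE, SE}"
    using step.exhaust by auto
  then have "finite (UNIV :: step set)"
    by (metis finite.emptyI finite.insertI)
  then have "finite {P. set P \<subseteq> (UNIV :: step set) \<and> length P = n}"
    by (rule finite_lists_length_eq)
  then show ?thesis
    by (rule rev_finite_subset) (auto simp: descents_def)
qed

lemma descent_sum_from_0: "descent_sum c n 0 = moment c n"
  by (simp add: descent_sum_def moment_def descents_def dyck_paths_def
      descent_weight_def path_weight_def)

text \<open>Start heights are integers so that the recurrence may refer to \<open>k - 1\<close> at
  \<open>k = 0\<close>. The zero value there matches \<open>assoc_hermite_neg\<close> and absorbs
  the factor \<open>c - 1\<close>.\<close>

lemma descent_sum_neg: "k < 0 \<Longrightarrow> descent_sum c n k = 0"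
proof -
  assume "k < 0"
  then have "descents n k = {}"
    by (force simp: descents_def)
  then show ?thesis
    by (simp add: descent_sum_def)
qed

lemma descent_sum_0: "descent_sum c 0 k = (if k = 0 then 1 else 0)"
proof -
  have "descents 0 k = (if k = 0 then {[]} else {})"
    by (auto simp: descents_def)
  then show ?thesis
    by (simp add: descent_sum_def descent_weight_def)
qed

text \<open>The condition at position 0 is just \<open>k \<ge> 0\<close>; the later ones are those
  of the tail, started one step further on.\<close>

lemma Cons_in_descents_iff:
  assumes "k \<ge> 0"
  shows "s # P \<in> descents (Suc n) k \<longleftrightarrow> P \<in> descents n (k + step_rise s)"
proof -
  have "(\<forall>i\<le>Suc n. k + height (s # P) i \<ge> 0) \<longleftrightarrow> (\<forall>i\<le>n. k + height (s # P) (Suc i) \<ge> 0)"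
    using assms by (metis Suc_le_mono height_0 add_0_right not0_implies_Suc)
  then show ?thesis
    by (simp add: descents_def add.assoc)
qed

lemma descents_Suc:
  assumes "k \<ge> 0"
  shows "descents (Suc n) k = (#) NE ` descents n (k + 1) \<union> (#) SE ` descents n (k - 1)"
    (is "?L = ?R")
proof (rule set_eqI)
  fix P
  show "P \<in> ?L \<longleftrightarrow> P \<in> ?R"
  proof (cases P)
    case Nil
    then show ?thesis
      by (auto simp: descents_def)
  next
    case (Cons s Q)
    then show ?thesis
      using Cons_in_descents_iff[OF assms, of s Q n] by (cases s) auto
  qed
qed

lemma descent_weight_Cons:
  "descent_weight c k (s # P) = step_weight c k s * descent_weight c (k + step_rise s) P"
  by (simp add: descent_weight_def prod.lessThan_Suc_shift add.assoc del: prod.lessThan_Suc)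

lemma descent_sum_Suc:
  assumes "k \<ge> 0"
  shows "descent_sum c (Suc n) k =
    descent_sum c n (k + 1) + (of_int (k - 1) + c) * descent_sum c n (k - 1)"
proof -
  have "descent_sum c (Suc n) k =
      (\<Sum>P\<in>(#) NE ` descents n (k + 1). descent_weight c k P) +
      (\<Sum>P\<in>(#) SE ` descents n (k - 1). descent_weight c k P)"
    unfolding descent_sum_def descents_Suc[OF assms]
    by (rule sum.union_disjoint) (auto simp: finite_descents)
  then show ?thesis
    by (simp add: sum.reindex descent_weight_Cons descent_sum_def sum_distrib_left)
qed

text \<open>A step lowers the height by at most 1; in the recurrence both \<open>k + 1\<close> and
  \<open>k - 1\<close> stay out of reach.\<close>

lemma descent_sum_short: "int n < k \<Longrightarrow> descent_sum c n k = 0"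
  by (induction n arbitrary: k) (simp_all add: descent_sum_0 descent_sum_Suc)

text \<open>From height \<open>n + 1\<close> with \<open>n + 1\<close> steps an initial rise is
  fatal, and the initial descent contributes \<open>n + c\<close>, the next Pochhammer
  factor.\<close>

lemma descent_sum_diag: "descent_sum c n (int n) = pochhammer c n"
  by (induction n)
    (simp_all add: descent_sum_0 descent_sum_Suc descent_sum_short pochhammer_Suc algebra_simps)

section \<open>The functional on products with \<open>assoc_hermite\<close>\<close>

lemma moment_functional_sum:
  "moment_functional c (\<Sum>i\<in>A. f i) = (\<Sum>i\<in>A. moment_functional c (f i))"
proof (induction A rule: infinite_finite_induct)
  case (insert x F)
  then show ?case
    by (simp add: moment_functional_add)
qed (simp_all add: moment_functional_def)

lemma X_mult_assoc_hermite:
  assumes "k \<ge> 0"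
  shows "[:0, 1:] * assoc_hermite c k =
    assoc_hermite c (k + 1) + smult (of_int (k - 1) + c) (assoc_hermite c (k - 1))"
  using assoc_hermite_rec[OF assms, of c] by simp

lemma moment_functional_power_hermite_Suc:
  assumes "k \<ge> 0"
  shows "moment_functional c ([:0, 1:] ^ Suc n * assoc_hermite c k) =
    moment_functional c ([:0, 1:] ^ n * assoc_hermite c (k + 1)) +
    (of_int (k - 1) + c) * moment_functional c ([:0, 1:] ^ n * assoc_hermite c (k - 1))"
proof -
  have "[:0, 1:] ^ Suc n * assoc_hermite c k = [:0, 1:] ^ n * ([:0, 1:] * assoc_hermite c k)"
    by (simp only: power_Suc2 mult.assoc)
  also have "\<dots> = [:0, 1:] ^ n * assoc_hermite c (k + 1) +
      smult (of_int (k - 1) + c) ([:0, 1:] ^ n * assoc_hermite c (k - 1))"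
    by (simp only: X_mult_assoc_hermite[OF assms] distrib_left mult_smult_right)
  finally show ?thesis
    by (simp only: moment_functional_add moment_functional_smult)
qed

text \<open>The shared recurrence, solved for its \<open>k + 1\<close> term, determines the value at
  \<open>(n, k + 1)\<close> from those at \<open>(n + 1, k)\<close> and \<open>(n, k - 1)\<close>.
  Hence strong induction on \<open>k\<close> with \<open>n\<close> arbitrary.\<close>

lemma moment_functional_power_hermite:
  "moment_functional c ([:0, 1:] ^ n * assoc_hermite c (int k)) = descent_sum c n (int k)"
proof (induction k arbitrary: n rule: less_induct)
  case (less k)
  show ?case
  proof (cases k)
    case 0
    then show ?thesis
      by (simp only: of_nat_0 assoc_hermite_0 mult_1_right moment_functional_power
          descent_sum_from_0)
  next
    case (Suc j)
    have pred: "moment_functional c ([:0, 1:] ^ n * assoc_hermite c (int j - 1)) =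
        descent_sum c n (int j - 1)"
    proof (cases j)
      case 0
      then show ?thesis
        by (simp add: assoc_hermite_neg descent_sum_neg moment_functional_def)
    next
      case (Suc i)
      then show ?thesis
        using less.IH[of i n] \<open>k = Suc j\<close> by simp
    qed
    have "moment_functional c ([:0, 1:] ^ Suc n * assoc_hermite c (int j)) =
        descent_sum c (Suc n) (int j)"
      using less.IH[of j "Suc n"] Suc by simp
    \<comment> \<open>Both sides are expanded by the recurrence; their terms of index
      \<open>j - 1\<close> agree by \<open>pred\<close> and cancel.\<close>
    then have "moment_functional c ([:0, 1:] ^ n * assoc_hermite c (int j + 1)) =
        descent_sum c n (int j + 1)"
      unfolding moment_functional_power_hermite_Suc[OF of_nat_0_le_iff]
        descent_sum_Suc[OF of_nat_0_le_iff] pred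
      by (rule add_right_imp_eq)
    then show ?thesis
      by (simp add: Suc add.commute)
  qed
qed

lemma moment_functional_mult_hermite:
  "moment_functional c (p * assoc_hermite c (int k)) =
    (\<Sum>i\<le>degree p. coeff p i * descent_sum c i (int k))"
proof -
  have "p * assoc_hermite c (int k) =
      (\<Sum>i\<le>degree p. smult (coeff p i) ([:0, 1:] ^ i * assoc_hermite c (int k)))"
    by (subst poly_as_sum_of_monoms[of p, symmetric])
      (simp add: monom_altdef sum_distrib_right)
  then show ?thesis
    by (simp only: moment_functional_sum moment_functional_smult moment_functional_power_hermite)
qed

section \<open>Degrees and leading coefficients\<close>

lemma degree_linear_mult_monic:
  fixes p :: "'a::comm_ring_1 poly"
  assumes "lead_coeff p = 1"
  shows "degree ([:a, 1:] * p) = Suc (degree p)" "lead_coeff ([:a, 1:] * p) = 1"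
proof -
  have "p \<noteq> 0"
    using assms by auto
  \<comment> \<open>The ring may have zero divisors, so the degree of the product is found by
    splitting it into \<open>smult a p + pCons 0 p\<close>, where the second summand
    dominates.\<close>
  then have "degree (smult a p) < degree (pCons 0 p)"
    using degree_smult_le[of a p] by simp
  then show deg: "degree ([:a, 1:] * p) = Suc (degree p)"
    using \<open>p \<noteq> 0\<close> by (simp add: degree_add_eq_right)
  show "lead_coeff ([:a, 1:] * p) = 1"
    unfolding deg using assms by (simp add: coeff_eq_0)
qed

lemma assoc_hermite_monic:
  "degree (assoc_hermite c (int n)) = n \<and> lead_coeff (assoc_hermite c (int n)) = 1"
proof (induction n rule: less_induct)
  case (less n)
  show ?case
  proof (cases n)
    case 0
    then show ?thesis
      by (simp add: assoc_hermite_0)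
  next
    case (Suc j)
    define q where "q = - smult (of_int (int j - 1) + c) (assoc_hermite c (int j - 1))"
    define p where "p = [:0, 1:] * assoc_hermite c (int j)"
    have eq: "assoc_hermite c (int n) = p + q"
      using assoc_hermite_rec[of "int j" c] by (simp add: Suc p_def q_def add.commute)
    have "degree q < n"
    proof (cases j)
      case 0
      then show ?thesis
        by (simp add: q_def assoc_hermite_neg Suc)
    next
      case (Suc i)
      have "degree q \<le> degree (assoc_hermite c (int i))"
        unfolding q_def degree_minus using Suc by (simp add: degree_smult_le)
      then show ?thesis
        using less.IH[of i] \<open>n = Suc j\<close> Suc by simp
    qed
    moreover have "degree p = n" "lead_coeff p = 1"
      using less.IH[of j] Suc degree_linear_mult_monic[of "assoc_hermite c (int j)" 0]
      unfolding p_def by auto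
    ultimately show ?thesis
      by (simp add: eq degree_add_eq_left coeff_eq_0)
  qed
qed

section \<open>Orthogonality and squared norms\<close>

lemma moment_functional_hermite_le:
  assumes "n \<le> m"
  shows "moment_functional c (assoc_hermite c (int n) * assoc_hermite c (int m)) =
    (if n = m then pochhammer c n else 0)"
proof -
  let ?H = "assoc_hermite c (int n)"
  have monic: "degree ?H = n" "coeff ?H n = 1"
    using assoc_hermite_monic[of c n] by auto
  have "moment_functional c (?H * assoc_hermite c (int m)) =
      (\<Sum>i<n. coeff ?H i * descent_sum c i (int m)) + descent_sum c n (int m)"
    by (simp add: moment_functional_mult_hermite monic flip: lessThan_Suc_atMost)
  \<comment> \<open>For \<open>i < n \<le> m\<close>, \<open>i\<close> steps cannot descend from
    \<open>m\<close>, so only the leading monomial of the factor of smaller degree survives.\<close>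
  also have "\<dots> = descent_sum c n (int m)"
    using assms by (simp add: descent_sum_short)
  finally show ?thesis
    using assms by (simp add: descent_sum_diag descent_sum_short)
qed

lemma moment_functional_hermite:
  "moment_functional c (assoc_hermite c (int n) * assoc_hermite c (int m)) =
    (if n = m then pochhammer c n else 0)"
proof (cases "n \<le> m")
  case True
  then show ?thesis
    by (rule moment_functional_hermite_le)
next
  case False
  then show ?thesis
    using moment_functional_hermite_le[of m n c] by (simp add: mult.commute)
qed

text \<open>Being monic in the indeterminate, the squared norm is nonzero whatever the
  characteristic of the ring.\<close>

lemma lead_coeff_pochhammer_X:
  "lead_coeff (pochhammer [:0, 1 :: 'a::comm_ring_1:] n) = 1"
proof (induction n)
  case (Suc n)
  have "pochhammer [:0, 1 :: 'a:] (Suc n) = [:of_nat n, 1:] * pochhammer [:0, 1:] n"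
    by (simp add: pochhammer_Suc of_nat_poly mult.commute)
  then show ?case
    using degree_linear_mult_monic(2)[OF Suc] by metis
qed simp

theorem mainTheorem3:
  fixes c :: "'a::comm_ring_1 poly"
  assumes "c = [:0, 1:]"
  shows "orthogonal_polys (moment_functional c) (\<lambda>n. assoc_hermite c (int n)) \<and>
    (\<forall>n m. moment_functional c (assoc_hermite c (int n) * assoc_hermite c (int m)) =
      (if n = m then pochhammer c n else 0))"
proof -
  have "pochhammer c n \<noteq> 0" for n
    using lead_coeff_pochhammer_X[where 'a = 'a, of n] assms by auto
  then show ?thesis
    by (simp add: orthogonal_polys_def moment_functional_hermite assoc_hermite_monic)
qed

end
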